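(* Let $n,k$ be positive integers with $2\le k<n$, and let $G_{n,k}$ be the transition digraph for $\mathcal P(n,k)$. Then $G_{n,k}$ has an Eulerian cycle (a closed directed walk traversing each edge exactly once).
   Context: $[m]=\{1,\dots,m\}$; $\mathcal P(n,k)$ is the set of partitions of $[n]$ into exactly $k$ nonempty parts ($k$-partitions of $[n]$). For $m\ge 1$, a representation of a partition $p$ of $[m]$ with at most $k$ parts is a string $r_1\cdots r_m$ over the alphabet $[k]$ such that $r_i=r_j$ if and only if $i,j$ lie in the same part of $p$. The transition digraph $G_{n,k}$: its vertices are all $k$-partitions and all $(k-1)$-partitions of $[n-1]$. There is an edge from $v$ to $w$ if and only if there are a representation of $v$ and a representation of $w$ such that the last $n-2$ symbols of the former equal the first $n-2$ symbols of the latter and the length-$n$ string formed by overlaying the two at this common substring is a representation of a $k$-partition of $[n]$. Equivalently, the edges are the $k$-partitions $p$ of $[n]$: the edge $p$ goes from the partition of $[n-1]$ represented by the first $n-1$ symbols of a representation of $p$ to the partition of $[n-1]$ represented by the last $n-1$ symbols. Loops are allowed. *)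

theory Defs
  imports
    "HOL-Library.Disjoint_Sets"
    "Graph_Theory.Digraph"
    "Graph_Theory.Arc_Walk"
begin

definition k_partitions :: "nat \<Rightarrow> nat \<Rightarrow> nat set set set" where
  "k_partitions n k = {P. partition_on {1..n} P \<and> card P = k}"

(* Symbols and positions are numbered from 1, whereas list indices start at 0. *)
definition is_representation :: "nat \<Rightarrow> nat \<Rightarrow> nat list \<Rightarrow> nat set set \<Rightarrow> bool" where
  "is_representation m k r P \<longleftrightarrow>
     length r = m \<and> set r \<subseteq> {1..k} \<and>
     (\<forall>i\<in>{1..m}. \<forall>j\<in>{1..m}. r ! (i - 1) = r ! (j - 1) \<longleftrightarrow> (\<exists>A\<in>P. i \<in> A \<and> j \<in> A))"

definition transition_vertices :: "nat \<Rightarrow> nat \<Rightarrow> nat set set set" where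
  "transition_vertices n k = k_partitions (n - 1) k \<union> k_partitions (n - 1) (k - 1)"

(* The strings r and s have length n - 1, so "drop 1 r" consists of the last n - 2
   symbols of r, and "r @ drop (n - 2) s" is r extended by the last symbol of s, that is,
   the overlay of r and s along their common substring of length n - 2. *)
definition transition_edge :: "nat \<Rightarrow> nat \<Rightarrow> nat set set \<Rightarrow> nat set set \<Rightarrow> bool" where
  "transition_edge n k v w \<longleftrightarrow>
     (\<exists>r s. is_representation (n - 1) k r v \<and> is_representation (n - 1) k s w \<and>
        drop 1 r = take (n - 2) s \<and>
        (\<exists>P\<in>k_partitions n k. is_representation n k (r @ drop (n - 2) s) P))"

definition transition_digraph ::
    "nat \<Rightarrow> nat \<Rightarrow> (nat set set, nat set set \<times> nat set set) pre_digraph" where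
  "transition_digraph n k =
     \<lparr> verts = transition_vertices n k,
       arcs = {(v, w). v \<in> transition_vertices n k \<and> w \<in> transition_vertices n k \<and>
                       transition_edge n k v w},
       tail = fst, head = snd \<rparr>"

(* A trail is a directed walk, given by its list of arcs, that repeats no arc. *)
definition eulerian_cycle :: "('a, 'b) pre_digraph \<Rightarrow> 'a \<Rightarrow> 'b list \<Rightarrow> bool" where
  "eulerian_cycle G u p \<longleftrightarrow> pre_digraph.trail G u p u \<and> set p = arcs G"

end

theory Submission
  imports Defs "Graph_Theory.Euler"
begin

text \<open>
  A vertex is the kernel of a word \<open>r\<close> of length \<open>n - 1\<close> over \<open>[k]\<close> with at least \<open>k - 1\<close> letters,
  and an arc is the kernel of a word of length \<open>n\<close> that uses all of \<open>[k]\<close>; the first and the last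
  \<open>n - 1\<close> letters of that word give the tail and the head. The arcs leaving \<open>r\<close> correspond to the
  letters \<open>c\<close> with \<open>set r \<union> {c} = [k]\<close>, and so do the arcs entering \<open>r\<close>, hence the digraph is
  balanced. Appending again and again a letter that does not occur among the last \<open>k - 1\<close> ones leads
  from every vertex to the vertex of the word \<open>1 2 \<dots> k 1 2 \<dots> k 1 \<dots>\<close>, hence the digraph is connected.
  Euler's theorem applies.
\<close>

section \<open>Partitions as kernels of words\<close>

text \<open>Fibres of the map from positions to letters. Positions start at 1 to fit
  \<open>k_partitions\<close>, hence the index \<open>i - 1\<close>; ranging over
  \<open>set r\<close> only keeps empty fibres out.\<close>

definition word_kernel :: "'a list \<Rightarrow> nat set set" where
  "word_kernel r = (\<lambda>a. {i \<in> {1..length r}. r ! (i - 1) = a}) ` set r"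

lemma ex_position:
  assumes "a \<in> set r"
  shows "\<exists>i\<in>{1..length r}. r ! (i - 1) = a"
proof -
  obtain j where "j < length r" "r ! j = a"
    using assms by (auto simp: in_set_conv_nth)
  then show ?thesis by (intro bexI[of _ "Suc j"]) auto
qed

lemma kernel_same_part:
  assumes "i \<in> {1..length r}" "j \<in> {1..length r}"
  shows "(\<exists>A\<in>word_kernel r. i \<in> A \<and> j \<in> A) \<longleftrightarrow> r ! (i - 1) = r ! (j - 1)"
  using assms by (auto simp: word_kernel_def intro!: nth_mem)

lemma partition_on_kernel: "partition_on {1..length r} (word_kernel r)"
proof (rule partition_onI)
  show "\<Union> (word_kernel r) = {1..length r}"
    by (fastforce simp: word_kernel_def intro!: nth_mem)
  show "{} \<notin> word_kernel r"
    unfolding word_kernel_def using ex_position[of _ r] by blast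
qed (auto simp: word_kernel_def disjnt_def)

lemma card_kernel: "card (word_kernel r) = card (set r)"
proof -
  have "inj_on (\<lambda>a. {i \<in> {1..length r}. r ! (i - 1) = a}) (set r)"
  proof (rule inj_onI)
    fix a b
    assume a: "a \<in> set r"
      and eq: "{i \<in> {1..length r}. r ! (i - 1) = a} = {i \<in> {1..length r}. r ! (i - 1) = b}"
    obtain i where "i \<in> {1..length r}" "r ! (i - 1) = a"
      using ex_position[OF a] by blast
    then show "a = b" using eq by blast
  qed
  then show ?thesis by (simp add: word_kernel_def card_image)
qed

text \<open>A part is the class of any of its elements under the relation of lying in a common part,
  so this relation alone determines the partition.\<close>

lemma partition_on_eqI:
  assumes P: "partition_on A P" and Q: "partition_on A Q"
    and same: "\<And>i j. i \<in> A \<Longrightarrow> j \<in> A \<Longrightarrow> (\<exists>X\<in>P. i \<in> X \<and> j \<in> X) \<longleftrightarrow> (\<exists>X\<in>Q. i \<in> X \<and> j \<in> X)"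
  shows "P = Q"
proof -
  have parts: "R = (\<lambda>i. {j \<in> A. \<exists>X\<in>R. i \<in> X \<and> j \<in> X}) ` A" if R: "partition_on A R" for R
  proof -
    have part: "X = {j \<in> A. \<exists>Y\<in>R. i \<in> Y \<and> j \<in> Y}" if "X \<in> R" "i \<in> X" for X i
      using that partition_onD1[OF R] partition_onD2[OF R] by (auto simp: disjoint_def)
    show ?thesis
    proof (intro equalityI subsetI)
      fix X assume X: "X \<in> R"
      then obtain i where i: "i \<in> X" using partition_onD3[OF R] by fastforce
      have "i \<in> A" using X i partition_onD1[OF R] by blast
      then show "X \<in> (\<lambda>i. {j \<in> A. \<exists>X\<in>R. i \<in> X \<and> j \<in> X}) ` A"
        using part[OF X i] by blast
    next
      fix X assume "X \<in> (\<lambda>i. {j \<in> A. \<exists>X\<in>R. i \<in> X \<and> j \<in> X}) ` A"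
      then obtain i where i: "i \<in> A" "X = {j \<in> A. \<exists>X\<in>R. i \<in> X \<and> j \<in> X}" by blast
      then obtain Y where Y: "Y \<in> R" "i \<in> Y" using partition_onD1[OF R] by blast
      then show "X \<in> R" using part[OF Y] i by metis
    qed
  qed
  have "(\<lambda>i. {j \<in> A. \<exists>X\<in>P. i \<in> X \<and> j \<in> X}) ` A = (\<lambda>i. {j \<in> A. \<exists>X\<in>Q. i \<in> X \<and> j \<in> X}) ` A"
    using same by (intro image_cong Collect_cong refl conj_cong) auto
  then show ?thesis using parts[OF P] parts[OF Q] by simp
qed

text \<open>Trades positions counted from 1 for list indices counted from 0, so that kernels can be
  compared through letters alone.\<close>

lemma kernel_eq_iff:
  assumes len: "length x = length y"
  shows "word_kernel x = word_kernel y \<longleftrightarrow>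
    (\<forall>i<length x. \<forall>j<length x. x ! i = x ! j \<longleftrightarrow> y ! i = y ! j)"
proof
  assume eq: "word_kernel x = word_kernel y"
  show "\<forall>i<length x. \<forall>j<length x. x ! i = x ! j \<longleftrightarrow> y ! i = y ! j"
  proof (intro allI impI)
    fix i j assume "i < length x" "j < length x"
    then show "x ! i = x ! j \<longleftrightarrow> y ! i = y ! j"
      using kernel_same_part[of "Suc i" x "Suc j"] kernel_same_part[of "Suc i" y "Suc j"] eq len
      by simp
  qed
next
  assume same: "\<forall>i<length x. \<forall>j<length x. x ! i = x ! j \<longleftrightarrow> y ! i = y ! j"
  show "word_kernel x = word_kernel y"
  proof (rule partition_on_eqI[of "{1..length x}"])
    show "partition_on {1..length x} (word_kernel x)" by (rule partition_on_kernel)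
    show "partition_on {1..length x} (word_kernel y)" using partition_on_kernel[of y] len by simp
    fix i j assume ij: "i \<in> {1..length x}" "j \<in> {1..length x}"
    then have "i - 1 < length x" "j - 1 < length x" by auto
    then show "(\<exists>X\<in>word_kernel x. i \<in> X \<and> j \<in> X) \<longleftrightarrow> (\<exists>X\<in>word_kernel y. i \<in> X \<and> j \<in> X)"
      using same ij len by (simp add: kernel_same_part)
  qed
qed

lemma kernel_map:
  assumes "inj_on f (set x)"
  shows "word_kernel (map f x) = word_kernel x"
  using assms by (subst kernel_eq_iff) (auto simp: inj_on_eq_iff)

text \<open>Converse of \<open>kernel_map\<close>. The renaming sends a letter of \<open>x\<close>
  to the letter of \<open>y\<close> at some position where it occurs; equality of the kernels makes
  the choice of that position irrelevant and the renaming injective.\<close>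

lemma kernel_eq_imp_map:
  assumes len: "length x = length y" and eq: "word_kernel x = word_kernel y"
  shows "\<exists>f. inj_on f (set x) \<and> y = map f x"
proof -
  have same: "x ! i = x ! j \<longleftrightarrow> y ! i = y ! j" if "i < length x" "j < length x" for i j
    using that eq kernel_eq_iff[OF len] by blast
  define f where "f a = y ! (SOME i. i < length x \<and> x ! i = a)" for a
  have f: "f (x ! i) = y ! i" if "i < length x" for i
  proof -
    have "(SOME j. j < length x \<and> x ! j = x ! i) < length x \<and>
        x ! (SOME j. j < length x \<and> x ! j = x ! i) = x ! i"
      by (rule someI[of _ i]) (use that in simp)
    then show ?thesis unfolding f_def using same[OF _ that] by blast
  qed
  have "inj_on f (set x)"
    by (rule inj_onI) (metis f same in_set_conv_nth)
  moreover have "y = map f x"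
    using len f by (intro nth_equalityI) auto
  ultimately show ?thesis by blast
qed

text \<open>The renaming between the two words fixes every letter of \<open>u\<close> and sends
  \<open>c\<close> to \<open>d\<close>. If \<open>c\<close> occurs in \<open>u\<close>, then
  \<open>c\<close> is fixed; if \<open>d\<close> does, then \<open>c\<close> and \<open>d\<close>
  have the same image, and injectivity applies. Two letters new to \<open>u\<close> would be
  interchangeable. This will separate arcs leaving a vertex.\<close>

lemma kernel_snoc_cancel:
  assumes eq: "word_kernel (u @ [c]) = word_kernel (u @ [d])" and mem: "c \<in> set u \<or> d \<in> set u"
  shows "c = d"
proof -
  obtain f where f: "inj_on f (set (u @ [c]))" "u @ [d] = map f (u @ [c])"
    using kernel_eq_imp_map[OF _ eq] by auto
  then have "d = f c" and fix_u: "\<And>a. a \<in> set u \<Longrightarrow> f a = a"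
    by (auto simp: map_eq_conv[of id, simplified])
  then show ?thesis using mem f(1) by (auto simp: inj_on_def)
qed

text \<open>Mirror image of \<open>kernel_snoc_cancel\<close>, for arcs entering a vertex.\<close>

lemma kernel_Cons_cancel:
  assumes eq: "word_kernel (c # u) = word_kernel (d # u)" and mem: "c \<in> set u \<or> d \<in> set u"
  shows "c = d"
proof -
  obtain f where f: "inj_on f (set (c # u))" "d # u = map f (c # u)"
    using kernel_eq_imp_map[OF _ eq] by auto
  then have "d = f c" and fix_u: "\<And>a. a \<in> set u \<Longrightarrow> f a = a"
    by (auto simp: map_eq_conv[of id, simplified])
  then show ?thesis using mem f(1) by (auto simp: inj_on_def)
qed

lemma is_representation_iff_kernel:
  assumes "partition_on {1..m} P"
  shows "is_representation m k r P \<longleftrightarrow> length r = m \<and> set r \<subseteq> {1..k} \<and> P = word_kernel r"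
proof
  assume rep: "is_representation m k r P"
  then have len: "length r = m" by (simp add: is_representation_def)
  have "P = word_kernel r"
  proof (rule partition_on_eqI[OF assms])
    show "partition_on {1..m} (word_kernel r)" using partition_on_kernel[of r] len by simp
    show "(\<exists>X\<in>P. i \<in> X \<and> j \<in> X) \<longleftrightarrow> (\<exists>X\<in>word_kernel r. i \<in> X \<and> j \<in> X)"
      if "i \<in> {1..m}" "j \<in> {1..m}" for i j
      using rep that len kernel_same_part[of i r j] by (simp add: is_representation_def)
  qed
  then show "length r = m \<and> set r \<subseteq> {1..k} \<and> P = word_kernel r"
    using rep by (simp add: is_representation_def)
next
  assume "length r = m \<and> set r \<subseteq> {1..k} \<and> P = word_kernel r"
  then show "is_representation m k r P"
    using kernel_same_part[of _ r] by (auto simp: is_representation_def)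
qed

text \<open>The alphabet size \<open>k\<close> is kept apart from the number \<open>j\<close> of
  parts, because the vertices with \<open>k - 1\<close> parts are also written over \<open>k\<close>
  letters.\<close>

lemma k_partitions_iff_kernel:
  assumes "j \<le> k"
  shows "P \<in> k_partitions m j \<longleftrightarrow>
    (\<exists>r. length r = m \<and> set r \<subseteq> {1..k} \<and> card (set r) = j \<and> P = word_kernel r)"
proof
  assume "P \<in> k_partitions m j"
  then have part: "partition_on {1..m} P" and card: "card P = j"
    by (auto simp: k_partitions_def)
  have "finite P" using part finite_elements by blast
  then obtain f where f: "bij_betw f P {1..j}"
    using card finite_same_card_bij[of P "{1..j}"] by auto
  define block where "block i = (THE A. A \<in> P \<and> i \<in> A)" for i
  have block: "block i = A" if "A \<in> P" "i \<in> A" for i A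
    unfolding block_def
  proof (rule the_equality)
    show "B = A" if "B \<in> P \<and> i \<in> B" for B
      using that \<open>A \<in> P\<close> \<open>i \<in> A\<close> partition_onD2[OF part] by (auto simp: disjoint_def)
  qed (use that in simp)
  have block_mem: "block i \<in> P \<and> i \<in> block i" if "i \<in> {1..m}" for i
    using that block partition_onD1[OF part] by blast
  \<comment> \<open>The letter at a position is the number that \<open>f\<close> gives to the part
    containing this position.\<close>
  define r where "r = map (f \<circ> block) [1..<Suc m]"
  have len: "length r = m" by (simp add: r_def)
  have nth: "r ! (i - 1) = f (block i)" if "i \<in> {1..m}" for i
    using that by (auto simp: r_def simp del: upt_Suc)
  have "set r \<subseteq> f ` P"
    using block_mem by (auto simp: r_def simp del: upt_Suc)
  also have "\<dots> \<subseteq> {1..k}" using f assms by (auto simp: bij_betw_def)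
  finally have sub: "set r \<subseteq> {1..k}" .
  have "r ! (i - 1) = r ! (j - 1) \<longleftrightarrow> (\<exists>A\<in>P. i \<in> A \<and> j \<in> A)"
    if "i \<in> {1..m}" "j \<in> {1..m}" for i j
  proof -
    have "r ! (i - 1) = r ! (j - 1) \<longleftrightarrow> block i = block j"
      using nth that block_mem f by (metis bij_betw_def inj_on_eq_iff)
    also have "\<dots> \<longleftrightarrow> (\<exists>A\<in>P. i \<in> A \<and> j \<in> A)"
      using block block_mem that by metis
    finally show ?thesis .
  qed
  then have "is_representation m k r P"
    using len sub by (simp add: is_representation_def)
  then have "P = word_kernel r" using is_representation_iff_kernel[OF part] by blast
  moreover have "card (set r) = j" using card card_kernel[of r] \<open>P = word_kernel r\<close> by simp
  ultimately show "\<exists>r. length r = m \<and> set r \<subseteq> {1..k} \<and> card (set r) = j \<and> P = word_kernel r"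
    using len sub by blast
next
  assume "\<exists>r. length r = m \<and> set r \<subseteq> {1..k} \<and> card (set r) = j \<and> P = word_kernel r"
  then show "P \<in> k_partitions m j"
    using partition_on_kernel card_kernel by (auto simp: k_partitions_def)
qed

text \<open>The complements in \<open>S\<close> of \<open>A\<close> and of its image have equal
  finite size, so a bijection between them completes \<open>f\<close>.\<close>

lemma inj_on_extend_bij_betw:
  assumes "finite S" "A \<subseteq> S" "inj_on f A" "f ` A \<subseteq> S"
  shows "\<exists>g. bij_betw g S S \<and> (\<forall>a\<in>A. g a = f a)"
proof -
  have "card (S - A) = card (S - f ` A)"
    using assms by (simp add: card_Diff_subset finite_subset card_image)
  then obtain h where h: "bij_betw h (S - A) (S - f ` A)"
    using finite_same_card_bij[of "S - A" "S - f ` A"] assms(1) by auto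
  have "bij_betw f A (f ` A)" using assms(3) by (simp add: bij_betw_def)
  then have "bij_betw (\<lambda>x. if x \<in> A then f x else h x) (A \<union> (S - A)) (f ` A \<union> (S - f ` A))"
    using h by (intro bij_betw_disjoint_Un) auto
  then have "bij_betw (\<lambda>x. if x \<in> A then f x else h x) S S"
    using assms(2,4) by (simp add: Un_absorb1)
  then show ?thesis by (intro exI[of _ "\<lambda>x. if x \<in> A then f x else h x"]) simp
qed

text \<open>A permutation of the whole alphabet, unlike a renaming of the letters of
  \<open>x\<close> only, can also be applied to a longer word containing \<open>x\<close>.\<close>

lemma kernel_eq_imp_map_bij_betw:
  assumes "length x = length y" "word_kernel x = word_kernel y" "set x \<subseteq> S" "set y \<subseteq> S" "finite S"
  shows "\<exists>g. bij_betw g S S \<and> y = map g x"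
proof -
  obtain f where f: "inj_on f (set x)" "y = map f x"
    using kernel_eq_imp_map assms(1,2) by blast
  then obtain g where "bij_betw g S S" "\<forall>a\<in>set x. g a = f a"
    using inj_on_extend_bij_betw[of S "set x" f] assms by auto
  then show ?thesis using f by (intro exI[of _ g]) auto
qed

section \<open>The transition digraph in terms of words\<close>

text \<open>At most \<open>k\<close> letters are available, so the lower bound on the number of
  letters used leaves exactly the two kinds of vertices.\<close>

lemma verts_transition_digraph_iff:
  assumes "1 \<le> k"
  shows "v \<in> verts (transition_digraph n k) \<longleftrightarrow>
    (\<exists>r. length r = n - 1 \<and> set r \<subseteq> {1..k} \<and> k - 1 \<le> card (set r) \<and> v = word_kernel r)"
proof -
  have "v \<in> verts (transition_digraph n k) \<longleftrightarrow>
      v \<in> k_partitions (n - 1) k \<or> v \<in> k_partitions (n - 1) (k - 1)"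
    by (simp add: transition_digraph_def transition_vertices_def)
  also have "\<dots> \<longleftrightarrow>
      (\<exists>r. length r = n - 1 \<and> set r \<subseteq> {1..k} \<and> card (set r) = k \<and> v = word_kernel r) \<or>
      (\<exists>r. length r = n - 1 \<and> set r \<subseteq> {1..k} \<and> card (set r) = k - 1 \<and> v = word_kernel r)"
    by (simp only: k_partitions_iff_kernel[OF le_refl[of k]]
        k_partitions_iff_kernel[OF diff_le_self[of k 1]])
  finally have "v \<in> verts (transition_digraph n k) \<longleftrightarrow>
      (\<exists>r. length r = n - 1 \<and> set r \<subseteq> {1..k} \<and>
        (card (set r) = k \<or> card (set r) = k - 1) \<and> v = word_kernel r)"
    by blast
  moreover have "card (set r) = k \<or> card (set r) = k - 1 \<longleftrightarrow> k - 1 \<le> card (set r)"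
    if "set r \<subseteq> {1..k}" for r
    using card_mono[OF _ that] assms by auto
  ultimately show ?thesis by blast
qed

text \<open>Removing the first or last symbol of a word that uses all \<open>k\<close> letters loses
  at most one letter, so both ends of an arc are vertices.\<close>

lemma insert_eq_letters:
  assumes "insert c (set u) = {1..k}"
  shows "set u \<subseteq> {1..k}" and "k - 1 \<le> card (set u)"
proof -
  have "card {1..k} \<le> Suc (card (set u))"
    unfolding assms[symmetric] by (simp add: card_insert_if)
  then show "k - 1 \<le> card (set u)" by simp
qed (use assms in blast)

text \<open>An overlay \<open>x\<close> has a kernel with \<open>k\<close> parts and only
  \<open>k\<close> letters at its disposal, so it uses them all. Conversely,
  \<open>butlast x\<close> and \<open>tl x\<close> are representations whose overlay is
  \<open>x\<close>.\<close>

lemma arcs_transition_digraph_iff: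
  assumes k: "1 \<le> k" and n: "2 \<le> n"
  shows "(v, w) \<in> arcs (transition_digraph n k) \<longleftrightarrow>
    (\<exists>x. length x = n \<and> set x = {1..k} \<and> v = word_kernel (butlast x) \<and> w = word_kernel (tl x))"
proof
  assume "(v, w) \<in> arcs (transition_digraph n k)"
  then have vw: "v \<in> transition_vertices n k" "w \<in> transition_vertices n k"
    and "transition_edge n k v w"
    by (auto simp: transition_digraph_def)
  then obtain r s P where r: "is_representation (n - 1) k r v"
    and s: "is_representation (n - 1) k s w"
    and overlap: "drop 1 r = take (n - 2) s"
    and P: "P \<in> k_partitions n k" "is_representation n k (r @ drop (n - 2) s) P"
    unfolding transition_edge_def by blast
  have "partition_on {1..n - 1} v" "partition_on {1..n - 1} w"
    using vw by (auto simp: transition_vertices_def k_partitions_def)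
  then have r': "length r = n - 1" "v = word_kernel r" and s': "length s = n - 1" "w = word_kernel s"
    using r s is_representation_iff_kernel by blast+
  define x where "x = r @ drop (n - 2) s"
  have "length (drop (n - 2) s) = 1" using s' n by simp
  then obtain c where c: "drop (n - 2) s = [c]"
    by (metis One_nat_def length_0_conv length_Suc_conv)
  have P': "partition_on {1..n} P" "card P = k" using P(1) by (auto simp: k_partitions_def)
  then have "length x = n" "set x \<subseteq> {1..k}" "P = word_kernel x"
    using P(2) is_representation_iff_kernel x_def by blast+
  moreover have "card (set x) = k" using \<open>P = word_kernel x\<close> P'(2) card_kernel[of x] by simp
  ultimately have "set x = {1..k}" by (intro card_subset_eq) auto
  moreover have "butlast x = r" by (simp add: x_def c)
  \<comment> \<open>Since \<open>r\<close> is nonempty, the symbol removed by \<open>tl\<close> is a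
    symbol of \<open>r\<close>, not the appended one.\<close>
  moreover have "r \<noteq> []" using r' n by auto
  then have "tl x = drop 1 r @ drop (n - 2) s" by (simp add: x_def drop_Suc)
  then have "tl x = s" by (metis overlap append_take_drop_id)
  ultimately show "\<exists>x. length x = n \<and> set x = {1..k} \<and> v = word_kernel (butlast x) \<and> w = word_kernel (tl x)"
    using \<open>length x = n\<close> r' s' by blast
next
  assume "\<exists>x. length x = n \<and> set x = {1..k} \<and> v = word_kernel (butlast x) \<and> w = word_kernel (tl x)"
  then obtain x where x: "length x = n" "set x = {1..k}"
    and v: "v = word_kernel (butlast x)" and w: "w = word_kernel (tl x)" by blast
  have ne: "x \<noteq> []" using x n by auto
  have "insert (last x) (set (butlast x)) = {1..k}"
    using ne x(2) by (cases x rule: rev_cases) auto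
  then have but: "set (butlast x) \<subseteq> {1..k}" "k - 1 \<le> card (set (butlast x))"
    by (rule insert_eq_letters)+
  have "insert (hd x) (set (tl x)) = {1..k}"
    using ne x(2) by (cases x) auto
  then have tl: "set (tl x) \<subseteq> {1..k}" "k - 1 \<le> card (set (tl x))"
    by (rule insert_eq_letters)+
  have "v \<in> verts (transition_digraph n k)"
    by (intro verts_transition_digraph_iff[OF k, THEN iffD2] exI[of _ "butlast x"])
      (use but v x(1) in simp)
  moreover have "w \<in> verts (transition_digraph n k)"
    by (intro verts_transition_digraph_iff[OF k, THEN iffD2] exI[of _ "tl x"])
      (use tl w x(1) in simp)
  ultimately have verts: "v \<in> transition_vertices n k" "w \<in> transition_vertices n k"
    by (simp_all add: transition_digraph_def)
  have "is_representation (n - 1) k (butlast x) v"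
    using is_representation_iff_kernel partition_on_kernel[of "butlast x"] but v x(1) by simp
  moreover have "is_representation (n - 1) k (tl x) w"
    using is_representation_iff_kernel partition_on_kernel[of "tl x"] tl w x(1) by simp
  moreover have "drop 1 (butlast x) = take (n - 2) (tl x)"
    using x(1) by (simp add: butlast_conv_take drop_take drop_Suc flip: numeral_2_eq_2)
  moreover have "butlast x @ drop (n - 2) (tl x) = x"
    using x(1) n ne by (metis Suc_diff_le Suc_1 append_take_drop_id butlast_conv_take diff_Suc_Suc drop_Suc)
  moreover have "word_kernel x \<in> k_partitions n k"
    using k_partitions_iff_kernel[of k k] x by fastforce
  moreover have "is_representation n k x (word_kernel x)"
    using is_representation_iff_kernel partition_on_kernel[of x] x by simp
  ultimately have "transition_edge n k v w"
    unfolding transition_edge_def by metis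
  then show "(v, w) \<in> arcs (transition_digraph n k)"
    using verts by (simp add: transition_digraph_def)
qed

lemma fin_digraph_transition_digraph: "fin_digraph (transition_digraph n k)"
proof
  have "transition_vertices n k \<subseteq> Pow (Pow {1..n - 1})"
    by (auto simp: transition_vertices_def k_partitions_def partition_on_def)
  then have fin: "finite (transition_vertices n k)"
    by (rule finite_subset) simp
  then show "finite (verts (transition_digraph n k))"
    by (simp add: transition_digraph_def)
  have "arcs (transition_digraph n k) \<subseteq> transition_vertices n k \<times> transition_vertices n k"
    by (auto simp: transition_digraph_def)
  then show "finite (arcs (transition_digraph n k))"
    by (rule finite_subset) (simp add: fin)
qed (auto simp: transition_digraph_def)

section \<open>Degrees\<close>

text \<open>For an arc word \<open>x\<close> whose \<open>butlast\<close> has the kernel of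
  \<open>r\<close>, a permutation of the alphabet turns \<open>x\<close> into \<open>r @ [c]\<close>
  without changing either end of the arc. So the arc is given by the letter \<open>c\<close>. Arcs
  being pairs of vertices, it remains to see that the head determines \<open>c\<close>.\<close>

lemma out_degree_kernel:
  assumes k: "1 \<le> k" and n: "2 \<le> n" and len: "length r = n - 1" and sub: "set r \<subseteq> {1..k}"
  shows "out_degree (transition_digraph n k) (word_kernel r) = card {c. insert c (set r) = {1..k}}"
proof -
  let ?C = "{c. insert c (set r) = {1..k}}" and ?f = "\<lambda>c. (word_kernel r, word_kernel (tl r @ [c]))"
  have ne: "r \<noteq> []" using len n by auto
  have "out_arcs (transition_digraph n k) (word_kernel r) = ?f ` ?C"
  proof (intro equalityI subsetI)
    fix e assume "e \<in> out_arcs (transition_digraph n k) (word_kernel r)"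
    then obtain w where e: "e = (word_kernel r, w)" "e \<in> arcs (transition_digraph n k)"
      by (cases e) (auto simp: out_arcs_def transition_digraph_def)
    from e(2)[unfolded e(1)] obtain x where x: "length x = n" "set x = {1..k}"
      and v: "word_kernel r = word_kernel (butlast x)" and w: "w = word_kernel (tl x)"
      using arcs_transition_digraph_iff[OF k n, THEN iffD1] by blast
    have "set (butlast x) \<subseteq> {1..k}" using x(2) by (auto dest: in_set_butlastD)
    then obtain g where g: "bij_betw g {1..k} {1..k}" "r = map g (butlast x)"
      using kernel_eq_imp_map_bij_betw[of "butlast x" r "{1..k}"] v len x sub by auto
    have "x \<noteq> []" using x n by auto
    then have gx: "map g x = r @ [g (last x)]"
      using g(2) by (metis append_butlast_last_id list.simps(8,9) map_append)
    have "insert (g (last x)) (set r) = set (map g x)" unfolding gx by simp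
    also have "\<dots> = {1..k}" using g(1) x(2) by (simp add: bij_betw_def)
    finally have "g (last x) \<in> ?C" by simp
    moreover have "inj_on g (set (tl x))"
      using g(1) x(2) by (metis bij_betw_def inj_on_subset list.set_sel(2) subsetI tl_Nil)
    then have "w = word_kernel (tl (map g x))" using w by (simp add: kernel_map flip: map_tl)
    then have "w = word_kernel (tl r @ [g (last x)])" using gx ne by simp
    ultimately show "e \<in> ?f ` ?C" using e by blast
  next
    fix e assume "e \<in> ?f ` ?C"
    then obtain c where c: "insert c (set r) = {1..k}" "e = ?f c" by blast
    then have "e \<in> arcs (transition_digraph n k)"
      using arcs_transition_digraph_iff[OF k n] len n ne
      by (auto intro!: exI[of _ "r @ [c]"])
    then show "e \<in> out_arcs (transition_digraph n k) (word_kernel r)"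
      using c by (simp add: out_arcs_def transition_digraph_def)
  qed
  moreover have "inj_on ?f ?C"
  proof (rule inj_onI)
    fix c d assume c: "c \<in> ?C" and d: "d \<in> ?C" and "?f c = ?f d"
    then have eq: "word_kernel (tl r @ [c]) = word_kernel (tl r @ [d])" by simp
    show "c = d"
    proof (rule ccontr)
      \<comment> \<open>Two different admissible letters both occur in \<open>r\<close>. At most one
        of them is \<open>hd r\<close>, so the other occurs in \<open>tl r\<close> and the last
        letter can be cancelled.\<close>
      assume "c \<noteq> d"
      moreover have "set r = insert (hd r) (set (tl r))" using ne by (cases r) auto
      moreover have "insert c (set r) = insert d (set r)" using c d by simp
      then have "c \<in> set r" "d \<in> set r" using \<open>c \<noteq> d\<close> by (metis insert_iff)+
      ultimately show False using kernel_snoc_cancel[OF eq] by (metis insert_iff)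
    qed
  qed
  ultimately show ?thesis by (simp add: out_degree_def card_image)
qed

text \<open>Same argument reversed: renaming turns an arc word into \<open>c # r\<close>, and the
  tail determines \<open>c\<close>. The count is the one found for \<open>out_degree\<close>, which
  gives balance.\<close>

lemma in_degree_kernel:
  assumes k: "1 \<le> k" and n: "2 \<le> n" and len: "length r = n - 1" and sub: "set r \<subseteq> {1..k}"
  shows "in_degree (transition_digraph n k) (word_kernel r) = card {c. insert c (set r) = {1..k}}"
proof -
  let ?C = "{c. insert c (set r) = {1..k}}" and ?f = "\<lambda>c. (word_kernel (c # butlast r), word_kernel r)"
  have ne: "r \<noteq> []" using len n by auto
  have "in_arcs (transition_digraph n k) (word_kernel r) = ?f ` ?C"
  proof (intro equalityI subsetI)
    fix e assume "e \<in> in_arcs (transition_digraph n k) (word_kernel r)"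
    then obtain v where e: "e = (v, word_kernel r)" "e \<in> arcs (transition_digraph n k)"
      by (cases e) (auto simp: in_arcs_def transition_digraph_def)
    from e(2)[unfolded e(1)] obtain x where x: "length x = n" "set x = {1..k}"
      and v: "v = word_kernel (butlast x)" and w: "word_kernel r = word_kernel (tl x)"
      using arcs_transition_digraph_iff[OF k n, THEN iffD1] by blast
    have "set (tl x) \<subseteq> {1..k}" using x(2) by (metis list.set_sel(2) subsetI tl_Nil)
    then obtain g where g: "bij_betw g {1..k} {1..k}" "r = map g (tl x)"
      using kernel_eq_imp_map_bij_betw[of "tl x" r "{1..k}"] w len x sub by auto
    have "x \<noteq> []" using x n by auto
    then have gx: "map g x = g (hd x) # r"
      using g(2) by (metis list.collapse list.simps(9))
    have "insert (g (hd x)) (set r) = set (map g x)" unfolding gx by simp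
    also have "\<dots> = {1..k}" using g(1) x(2) by (simp add: bij_betw_def)
    finally have "g (hd x) \<in> ?C" by simp
    moreover have "inj_on g (set (butlast x))"
      using g(1) x(2) by (metis bij_betw_def in_set_butlastD inj_on_subset subsetI)
    then have "v = word_kernel (butlast (map g x))" using v by (simp add: kernel_map flip: map_butlast)
    then have "v = word_kernel (g (hd x) # butlast r)" using gx ne by simp
    ultimately show "e \<in> ?f ` ?C" using e by blast
  next
    fix e assume "e \<in> ?f ` ?C"
    then obtain c where c: "insert c (set r) = {1..k}" "e = ?f c" by blast
    then have "e \<in> arcs (transition_digraph n k)"
      using arcs_transition_digraph_iff[OF k n] len n ne
      by (auto intro!: exI[of _ "c # r"])
    then show "e \<in> in_arcs (transition_digraph n k) (word_kernel r)"
      using c by (simp add: in_arcs_def transition_digraph_def)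
  qed
  moreover have "inj_on ?f ?C"
  proof (rule inj_onI)
    fix c d assume c: "c \<in> ?C" and d: "d \<in> ?C" and "?f c = ?f d"
    then have eq: "word_kernel (c # butlast r) = word_kernel (d # butlast r)" by simp
    show "c = d"
    proof (rule ccontr)
      assume "c \<noteq> d"
      moreover have "set r = insert (last r) (set (butlast r))"
        using ne by (cases r rule: rev_cases) auto
      moreover have "insert c (set r) = insert d (set r)" using c d by simp
      then have "c \<in> set r" "d \<in> set r" using \<open>c \<noteq> d\<close> by (metis insert_iff)+
      ultimately show False using kernel_Cons_cancel[OF eq] by (metis insert_iff)
    qed
  qed
  ultimately show ?thesis by (simp add: in_degree_def card_image)
qed

section \<open>Connectedness\<close>

text \<open>The parameter \<open>m\<close> counts the letters at the end of the word that are
  already under control: the condition is vacuous for \<open>m = 0\<close> and concerns the whole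
  word for \<open>m = length r\<close>. Writing \<open>length r \<le> i + m\<close> avoids truncated
  subtraction.\<close>

definition distinct_windows :: "nat \<Rightarrow> nat \<Rightarrow> 'a list \<Rightarrow> bool" where
  "distinct_windows k m r \<longleftrightarrow>
     (\<forall>i j. length r \<le> i + m \<and> i < j \<and> j < i + k \<and> j < length r \<longrightarrow> r ! i \<noteq> r ! j)"

text \<open>Dropping the first letter shifts indices by one, so pairs of old letters inherit the
  condition from \<open>r\<close>. A pair involving the new last letter is settled by the choice of
  \<open>c\<close>, since the dropped suffix contains every letter of \<open>r\<close> that is less
  than \<open>k\<close> places before \<open>c\<close>.\<close>

lemma distinct_windows_snoc:
  assumes r: "distinct_windows k m r" and c: "c \<notin> set (drop (length r + 1 - k) r)"
    and ne: "r \<noteq> []"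
  shows "distinct_windows k (Suc m) (tl r @ [c])"
  unfolding distinct_windows_def
proof (intro allI impI)
  fix i j
  assume "length (tl r @ [c]) \<le> i + Suc m \<and> i < j \<and> j < i + k \<and> j < length (tl r @ [c])"
  then have ij: "length r \<le> Suc i + m" "i < j" "j < i + k" "j < length r" using ne by auto
  then have "i < length r - 1" by simp
  then have i: "(tl r @ [c]) ! i = r ! Suc i" by (simp add: nth_append nth_tl)
  show "(tl r @ [c]) ! i \<noteq> (tl r @ [c]) ! j"
  proof (cases "Suc j < length r")
    case True
    then have "j < length r - 1" by simp
    then have "(tl r @ [c]) ! j = r ! Suc j" by (simp add: nth_append nth_tl)
    then show ?thesis using i r ij True unfolding distinct_windows_def by simp
  next
    case False
    then have j: "Suc j = length r" using ij by simp
    then have "j = length (tl r)" by simp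
    then have "(tl r @ [c]) ! j = c" by (simp only: nth_append_length)
    moreover have "r ! Suc i \<in> set (drop (length r + 1 - k) r)"
      unfolding in_set_conv_nth
      by (intro exI[of _ "Suc i - (length r + 1 - k)"]) (use ij j in auto)
    ultimately show ?thesis using i c by auto
  qed
qed

text \<open>Any \<open>k\<close> consecutive letters are distinct and therefore exhaust the
  alphabet. The following letter differs from the last \<open>k - 1\<close> of them, so it repeats
  the first: the word has period \<open>k\<close>. Its kernel thus depends only on its length and
  \<open>k\<close>.\<close>

lemma distinct_windows_nth_eq_iff:
  assumes win: "distinct_windows k (length s) s" and sub: "set s \<subseteq> {1..k}"
    and i: "i < length s" and j: "j < length s"
  shows "s ! i = s ! j \<longleftrightarrow> i mod k = j mod k"
proof -
  have k: "0 < k" using sub i nth_mem by fastforce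
  have neq: "s ! a \<noteq> s ! b" if "a < b" "b < a + k" "b < length s" for a b
    using win that unfolding distinct_windows_def by simp
  have period: "s ! (a + k) = s ! a" if a: "a + k < length s" for a
  proof -
    have "inj_on ((!) s) {a..<a + k}"
    proof (rule inj_onI)
      fix b c assume "b \<in> {a..<a + k}" "c \<in> {a..<a + k}" "s ! b = s ! c"
      then show "b = c" using neq[of b c] neq[of c b] a by (cases b c rule: linorder_cases) auto
    qed
    then have "card ((!) s ` {a..<a + k}) = card {1..k}" by (simp add: card_image)
    moreover have "(!) s ` {a..<a + k} \<subseteq> set s" using a by auto
    then have "(!) s ` {a..<a + k} \<subseteq> {1..k}" using sub by blast
    ultimately have "(!) s ` {a..<a + k} = {1..k}" by (intro card_subset_eq) auto
    moreover have "s ! (a + k) \<in> {1..k}" using sub a nth_mem by blast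
    ultimately have "s ! (a + k) \<in> (!) s ` {a..<a + k}" by simp
    then obtain b where "b \<in> {a..<a + k}" "s ! (a + k) = s ! b" by blast
    then show ?thesis using neq[of b "a + k"] a by (cases "b = a") auto
  qed
  have mod: "s ! a = s ! (a mod k)" if "a < length s" for a
    using that
  proof (induction a rule: less_induct)
    case (less a)
    show ?case
    proof (cases "a < k")
      case False
      then have "s ! a = s ! (a - k)" using period[of "a - k"] less.prems by simp
      also have "\<dots> = s ! ((a - k) mod k)" using less False k by simp
      finally show ?thesis using False by (simp add: le_mod_geq)
    qed simp
  qed
  have le: "i mod k < length s" "j mod k < length s"
    using i j by (meson le_less_trans mod_less_eq_dividend)+
  have lt: "i mod k < k" "j mod k < k" using k by auto
  have "s ! (i mod k) = s ! (j mod k) \<longleftrightarrow> i mod k = j mod k"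
    using neq[of "i mod k" "j mod k"] neq[of "j mod k" "i mod k"] le lt
    by (cases "i mod k" "j mod k" rule: linorder_cases) auto
  then show ?thesis using mod[OF i] mod[OF j] by simp
qed

text \<open>If \<open>r\<close> uses all letters, its last \<open>k - 1\<close> positions cannot
  hold all of them; otherwise \<open>r\<close> misses exactly one letter, which serves. The equation
  for \<open>insert c (set r)\<close> makes \<open>r @ [c]\<close> an arc word.\<close>

lemma ex_new_letter:
  assumes k: "1 \<le> k" "k \<le> length r + 1" and sub: "set r \<subseteq> {1..k}" and card: "k - 1 \<le> card (set r)"
  shows "\<exists>c. insert c (set r) = {1..k} \<and> c \<notin> set (drop (length r + 1 - k) r)"
proof (cases "set r = {1..k}")
  case True
  have "card (set (drop (length r + 1 - k) r)) \<le> length (drop (length r + 1 - k) r)"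
    by (rule card_length)
  also have "\<dots> < card {1..k}" using k by simp
  finally have "\<not> {1..k} \<subseteq> set (drop (length r + 1 - k) r)"
    by (meson List.finite_set card_mono leD)
  then show ?thesis using True by blast
next
  case False
  then obtain c where c: "c \<in> {1..k}" "c \<notin> set r" using sub by blast
  then have "card (insert c (set r)) \<ge> card {1..k}" using card k by simp
  then have "insert c (set r) = {1..k}" using c sub by (intro card_seteq) auto
  then show ?thesis using c by (meson in_set_dropD)
qed

text \<open>Here \<open>m\<close> is the number of arcs walked: each one appends a letter from
  \<open>ex_new_letter\<close> and drops the first letter.\<close>

lemma reachable_distinct_windows:
  assumes k: "1 \<le> k" "k \<le> n" and n: "2 \<le> n"
    and r: "length r = n - 1" "set r \<subseteq> {1..k}" "k - 1 \<le> card (set r)"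
  shows "\<exists>s. length s = n - 1 \<and> set s \<subseteq> {1..k} \<and> k - 1 \<le> card (set s) \<and> distinct_windows k m s \<and>
    word_kernel r \<rightarrow>\<^sup>*\<^bsub>transition_digraph n k\<^esub> word_kernel s"
proof -
  interpret fin_digraph "transition_digraph n k" by (rule fin_digraph_transition_digraph)
  show ?thesis
  proof (induction m)
    case 0
    have "word_kernel r \<in> verts (transition_digraph n k)"
      using verts_transition_digraph_iff[OF k(1)] r by blast
    then have "word_kernel r \<rightarrow>\<^sup>*\<^bsub>transition_digraph n k\<^esub> word_kernel r" by simp
    then show ?case using r by (auto simp: distinct_windows_def)
  next
    case (Suc m)
    then obtain s where s: "length s = n - 1" "set s \<subseteq> {1..k}" "k - 1 \<le> card (set s)"
      and win: "distinct_windows k m s"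
      and reach: "word_kernel r \<rightarrow>\<^sup>*\<^bsub>transition_digraph n k\<^esub> word_kernel s" by blast
    obtain c where c: "insert c (set s) = {1..k}" "c \<notin> set (drop (length s + 1 - k) s)"
      using ex_new_letter[of k s] s k n by auto
    have ne: "s \<noteq> []" using s n by auto
    let ?t = "tl s @ [c]"
    have "(word_kernel s, word_kernel ?t) \<in> arcs (transition_digraph n k)"
      using arcs_transition_digraph_iff[OF k(1) n] s c ne n by (auto intro!: exI[of _ "s @ [c]"])
    then have "word_kernel s \<rightarrow>\<^bsub>transition_digraph n k\<^esub> word_kernel ?t"
      by (auto simp: arcs_ends_conv transition_digraph_def image_iff)
    then have "word_kernel r \<rightarrow>\<^sup>*\<^bsub>transition_digraph n k\<^esub> word_kernel ?t"
      using reach by (rule reachable_adj_trans[rotated])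
    moreover have "distinct_windows k (Suc m) ?t"
      by (rule distinct_windows_snoc[OF win c(2) ne])
    \<comment> \<open>The arc word \<open>s @ [c]\<close> is also \<open>hd s # ?t\<close>, so
      \<open>?t\<close> lacks at most one of the \<open>k\<close> letters and is again the word of a
      vertex.\<close>
    moreover have "{1..k} = insert (hd s) (set ?t)"
      using c(1) ne by (cases s) auto
    then have "set ?t \<subseteq> {1..k}" "card {1..k} \<le> Suc (card (set ?t))"
      using card_insert_le_m1 by (blast, metis List.finite_set card_insert_if le_SucI order_refl)
    ultimately show ?case using s n by (intro exI[of _ ?t]) auto
  qed
qed

lemma connected_transition_digraph:
  assumes k: "1 \<le> k" "k < n"
  shows "connected (transition_digraph n k)"
proof -
  interpret fin_digraph "transition_digraph n k" by (rule fin_digraph_transition_digraph)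
  interpret S: pair_wf_digraph "mk_symmetric (transition_digraph n k)" ..
  have n: "2 \<le> n" using k by simp
  \<comment> \<open>The common target, the kernel of the cyclic word. Its letters are residues
    starting from 0, which is harmless as kernels ignore the names of letters.\<close>
  let ?z = "word_kernel (map (\<lambda>i. i mod k) [0..<n - 1])"
  have reach: "v \<rightarrow>\<^sup>*\<^bsub>transition_digraph n k\<^esub> ?z" if v: "v \<in> verts (transition_digraph n k)" for v
  proof -
    obtain r where r: "length r = n - 1" "set r \<subseteq> {1..k}" "k - 1 \<le> card (set r)" "v = word_kernel r"
      using v verts_transition_digraph_iff[OF k(1), THEN iffD1] by blast
    \<comment> \<open>After \<open>n - 1\<close> arcs every original letter has been replaced, so
      the condition holds along the whole word and forces its kernel.\<close>
    then obtain s where s: "length s = n - 1" "set s \<subseteq> {1..k}" "distinct_windows k (n - 1) s"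
      and rs: "word_kernel r \<rightarrow>\<^sup>*\<^bsub>transition_digraph n k\<^esub> word_kernel s"
      using reachable_distinct_windows[of k n r "n - 1"] k n by auto
    have "word_kernel s = ?z"
      using s by (subst kernel_eq_iff) (auto simp: distinct_windows_nth_eq_iff)
    then show ?thesis using rs r by simp
  qed
  show ?thesis
  proof (rule connectedI)
    \<comment> \<open>The word 1 2 ... k k ... k of length \<open>n - 1\<close>; it reaches the
      letter \<open>k\<close> because \<open>k < n\<close>, and shows that there is a
      vertex.\<close>
    let ?r = "map (\<lambda>i. min i k) [1..<n]"
    have "(\<lambda>i. min i k) ` {1..<n} = {1..k}"
    proof (intro equalityI subsetI)
      show "a \<in> (\<lambda>i. min i k) ` {1..<n}" if "a \<in> {1..k}" for a
        using that k by (intro image_eqI[of _ _ a]) auto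
    qed (use k in auto)
    then have "set ?r = {1..k}" by simp
    then have "word_kernel ?r \<in> verts (transition_digraph n k)"
      by (intro verts_transition_digraph_iff[OF k(1), THEN iffD2] exI[of _ ?r]) simp
    then show "verts (transition_digraph n k) \<noteq> {}" by blast
    fix u v assume "u \<in> verts (transition_digraph n k)" "v \<in> verts (transition_digraph n k)"
    \<comment> \<open>Connectedness is reachability in the symmetric closure, so the path from
      \<open>v\<close> to \<open>?z\<close> may be reversed and joined to the one from
      \<open>u\<close>.\<close>
    then have "u \<rightarrow>\<^sup>*\<^bsub>mk_symmetric (transition_digraph n k)\<^esub> ?z"
      and "v \<rightarrow>\<^sup>*\<^bsub>mk_symmetric (transition_digraph n k)\<^esub> ?z"
      using reach reachable_mk_symmetricI by blast+
    then show "u \<rightarrow>\<^sup>*\<^bsub>mk_symmetric (transition_digraph n k)\<^esub> v"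
      by (blast intro: S.reachable_trans symmetric_reachable[OF symmetric_mk_symmetric])
  qed
qed

theorem theorem5:
  fixes n k :: nat
  assumes "2 \<le> k" and "k < n"
  shows "\<exists>u p. eulerian_cycle (transition_digraph n k) u p"
proof -
  interpret fin_digraph "transition_digraph n k" by (rule fin_digraph_transition_digraph)
  have k: "1 \<le> k" and n: "2 \<le> n" using assms by auto
  have "connected (transition_digraph n k)"
    by (rule connected_transition_digraph[OF k assms(2)])
  moreover have "in_degree (transition_digraph n k) v = out_degree (transition_digraph n k) v"
    if v: "v \<in> verts (transition_digraph n k)" for v
  proof -
    obtain r where "length r = n - 1" "set r \<subseteq> {1..k}" "v = word_kernel r"
      using v verts_transition_digraph_iff[OF k, THEN iffD1] by blast
    then show ?thesis using in_degree_kernel[OF k n] out_degree_kernel[OF k n] by simp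
  qed
  ultimately obtain u p where "euler_trail u p u" using closed_euler1 by blast
  then show ?thesis unfolding eulerian_cycle_def euler_trail_def by blast
qed

end
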